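(* Let $p$ be a prime and $m\geqslant1$. The number of distinct (modulo $x^{p^m}-x$) Costas polynomials over $\mathbb{F}_{p^m}$ of the form $L(x^s)$, where $L(x)\in\mathbb{F}_{p^m}[x]$ is a linearized permutation polynomial and $s$ is a positive integer with $\gcd(s,p^m-1)=1$, is $$\frac{\phi(p^m-1)}{m}\prod_{k=0}^{m-1}(p^m-p^k),$$ where $\phi$ is Euler's totient function.
   Context: Let $q=p^m$. A linearized permutation polynomial over $\mathbb{F}_q$ is a polynomial $L(x)=\sum_{j=0}^{m-1}c_jx^{p^j}\in\mathbb{F}_q[x]$ inducing a permutation of $\mathbb{F}_q$. A Costas polynomial is a polynomial $f\in\mathbb{F}_q[x]$ with $f(0)=0$ such that $x\mapsto f(dx)-f(x)$ is a permutation of $\mathbb{F}_q$ for every $d\in\mathbb{F}_q$, $d\neq1$. *)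

theory Defs
  imports "HOL-Computational_Algebra.Polynomial" "HOL-Number_Theory.Totient"
begin

text \<open>The finite field with \<open>p ^ m\<close> elements is a type \<open>'a :: {field, finite}\<close> with
  \<open>CARD('a) = p ^ m\<close>. Polynomials are formal (type \<open>'a poly\<close>); they are not identified with the
  functions they induce.\<close>

definition linearized_permutation_poly :: "nat \<Rightarrow> nat \<Rightarrow> 'a :: {field, finite} poly \<Rightarrow> bool" where
  "linearized_permutation_poly p m L \<longleftrightarrow>
     (\<exists>c :: nat \<Rightarrow> 'a. L = (\<Sum>j<m. Polynomial.monom (c j) (p ^ j))) \<and> bij (poly L)"

definition costas_poly :: "'a :: {field, finite} poly \<Rightarrow> bool" where
  "costas_poly f \<longleftrightarrow>
     poly f 0 = 0 \<and> (\<forall>d. d \<noteq> 1 \<longrightarrow> bij (\<lambda>x. poly f (d * x) - poly f x))"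

end

theory Submission
  imports Defs "HOL-Library.Cardinality" "HOL-Number_Theory.Residues"
begin

text \<open>Put \<open>q = p ^ m\<close>. Every \<open>L(x\<^sup>s)\<close> with \<open>s\<close> coprime to \<open>q - 1\<close> is Costas, because
  \<open>L((d x)\<^sup>s) - L(x\<^sup>s) = L((d\<^sup>s - 1) x\<^sup>s)\<close> and \<open>d\<^sup>s \<noteq> 1\<close>; and residues modulo \<open>x\<^sup>q - x\<close> correspond to
  functions. So one counts functions \<open>L(x\<^sup>s)\<close> with \<open>s\<close> a totative of \<open>q - 1\<close>. As a reduced polynomial,
  \<open>L(x\<^sup>s)\<close> only involves exponents in the coset of \<open>s\<close> modulo the powers of \<open>p\<close>, so a pair \<open>(L, s)\<close>
  determines the same function as \<open>(L', t)\<close> only if \<open>t \<equiv> s p\<^sup>k\<close>; conversely each of the \<open>m\<close> such \<open>t\<close>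
  occurs, for the unique \<open>L'\<close> obtained by composing \<open>L\<close> with a power of Frobenius. Finally the
  permutations \<open>L\<close> are counted like ordered bases of the field over its prime field.\<close>

section \<open>Linear independence over the prime field\<close>

definition lincomb :: "nat \<Rightarrow> (nat \<Rightarrow> 'a :: comm_semiring_1) \<Rightarrow> (nat \<Rightarrow> 'a) \<Rightarrow> 'a" where
  "lincomb k a w = (\<Sum>i<k. a i * w i)"

text \<open>The prime field is \<open>range of_nat\<close>; coordinate vectors are kept extensional so that they can be
  counted and compared for equality.\<close>

definition prime_coords :: "nat \<Rightarrow> (nat \<Rightarrow> 'a :: comm_semiring_1) set" where
  "prime_coords k = {..<k} \<rightarrow>\<^sub>E range of_nat"

text \<open>Independence is phrased as uniqueness of coordinates, so that the span of an independent
  tuple is counted by its coordinate vectors.\<close>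

definition indep_tuple :: "nat \<Rightarrow> (nat \<Rightarrow> 'a :: comm_semiring_1) \<Rightarrow> bool" where
  "indep_tuple k w \<longleftrightarrow> inj_on (\<lambda>a. lincomb k a w) (prime_coords k)"

lemma lincomb_upd: "lincomb k a (w(k := v)) = lincomb k a w"
  "lincomb k (a(k := v)) w = lincomb k a w"
  by (auto simp: lincomb_def)

lemma indep_tuple_upd: "indep_tuple k (w(k := v)) \<longleftrightarrow> indep_tuple k w"
  by (simp add: indep_tuple_def lincomb_upd)

definition linearized_map :: "nat \<Rightarrow> nat \<Rightarrow> (nat \<Rightarrow> 'a :: comm_semiring_1) \<Rightarrow> 'a \<Rightarrow> 'a" where
  "linearized_map p m c x = (\<Sum>j<m. c j * x ^ (p ^ j))"

section \<open>Polynomials of degree below the field size\<close>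

lemma poly_sum_monom:
  fixes x :: "'a :: comm_semiring_1" and m :: nat
  shows "poly (\<Sum>j<m. Polynomial.monom (c j) (e j)) x = (\<Sum>j<m. c j * x ^ e j)"
  by (simp add: poly_sum Polynomial.poly_monom)

lemma coeff_sum_monom:
  fixes m :: nat
  assumes "inj_on e {..<m}" "j < m"
  shows "poly.coeff (\<Sum>i<m. Polynomial.monom (c i) (e i)) (e j) = c j"
proof -
  have "poly.coeff (\<Sum>i<m. Polynomial.monom (c i) (e i)) (e j) = (\<Sum>i<m. if i = j then c i else 0)"
    unfolding coeff_sum Polynomial.coeff_monom
    by (rule sum.cong) (use assms in \<open>auto simp: inj_on_def\<close>)
  also have "\<dots> = c j"
    using assms(2) by (subst sum.delta) auto
  finally show ?thesis .
qed

lemma degree_sum_monom_less: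
  fixes m :: nat
  assumes "\<And>j. j < m \<Longrightarrow> e j < n" "0 < n"
  shows "degree (\<Sum>j<m. Polynomial.monom (c j) (e j)) < n"
  using assms by (intro degree_sum_less) (auto intro: le_less_trans[OF degree_monom_le])

text \<open>A nonzero difference would have at most its degree many roots, yet here every field
  element is a root.\<close>

lemma poly_inject_card:
  fixes f g :: "'a :: {field, finite} poly"
  assumes "poly f = poly g" "degree f < CARD('a)" "degree g < CARD('a)"
  shows "f = g"
  using assms by (intro poly_eqI_degree[of UNIV]) auto

section \<open>Power maps and exponents modulo the order of the multiplicative group\<close>

text \<open>Multiplication by \<open>x\<close> permutes the nonzero elements; comparing their
  product before and after, it cancels.\<close>

lemma power_card_minus_one:
  fixes x :: "'a :: {field, finite}"
  assumes "x \<noteq> 0"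
  shows "x ^ (CARD('a) - 1) = 1"
proof -
  have "\<Prod>(UNIV - {0 :: 'a}) = (\<Prod>y\<in>UNIV - {0}. x * y)"
    by (rule prod.reindex_bij_witness[of _ "\<lambda>y. x * y" "\<lambda>y. y / x"]) (use assms in auto)
  also have "\<dots> = x ^ (CARD('a) - 1) * \<Prod>(UNIV - {0})"
    by (simp add: prod.distrib)
  finally show ?thesis by simp
qed

text \<open>The representative of \<open>k \<ge> 1\<close> modulo \<open>n\<close> in \<open>{1..n}\<close>, rather than in \<open>{0..<n}\<close>: with
  \<open>n = q - 1\<close> the reduced power then agrees with \<open>x ^ k\<close> also at \<open>x = 0\<close>.\<close>

definition reduce_exp :: "nat \<Rightarrow> nat \<Rightarrow> nat" where
  "reduce_exp n k = Suc ((k - 1) mod n)"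

lemma reduce_exp_cong:
  assumes "0 < k"
  shows "[reduce_exp n k = k] (mod n)"
proof -
  have "[Suc ((k - 1) mod n) = Suc (k - 1)] (mod n)"
    by (simp add: cong_def mod_Suc_eq)
  then show ?thesis using assms by (simp add: reduce_exp_def)
qed

lemma reduce_exp_bounds:
  assumes "0 < n"
  shows "0 < reduce_exp n k" "reduce_exp n k \<le> n"
  using assms by (simp_all add: reduce_exp_def Suc_leI)

lemma cong_imp_eq_positive:
  fixes a b n :: nat
  assumes "[a = b] (mod n)" "0 < a" "a \<le> n" "0 < b" "b \<le> n"
  shows "a = b"
  using assms by (metis cong_def le_neq_implies_less mod_less mod_self not_gr_zero)

lemma reduce_exp_eq_iff:
  assumes "0 < n" "0 < k" "0 < l"
  shows "reduce_exp n k = reduce_exp n l \<longleftrightarrow> [k = l] (mod n)"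
proof
  assume "reduce_exp n k = reduce_exp n l"
  then show "[k = l] (mod n)" using reduce_exp_cong assms by (metis cong_sym cong_trans)
next
  assume "[k = l] (mod n)"
  then have "[reduce_exp n k = reduce_exp n l] (mod n)" using reduce_exp_cong assms by (meson cong_sym cong_trans)
  then show "reduce_exp n k = reduce_exp n l" using reduce_exp_bounds[OF assms(1)] cong_imp_eq_positive by blast
qed

lemma reduce_exp_idem:
  assumes "0 < k" "k \<le> n"
  shows "reduce_exp n k = k"
  using assms by (simp add: reduce_exp_def)

lemma power_cong_card_minus_one:
  fixes x :: "'a :: {field, finite}"
  assumes "[k = l] (mod (CARD('a) - 1))" "0 < k" "0 < l"
  shows "x ^ k = x ^ l"
proof (cases "x = 0")
  case False
  have "x ^ k = x ^ (k mod (CARD('a) - 1))" for k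
  proof -
    have "x ^ k = x ^ ((CARD('a) - 1) * (k div (CARD('a) - 1)) + k mod (CARD('a) - 1))" by simp
    then show ?thesis
      by (simp only: power_add power_mult power_card_minus_one[OF False] power_one mult_1_left)
  qed
  then show ?thesis using assms(1) by (metis cong_def)
qed (use assms in \<open>simp add: zero_power\<close>)

lemma card_field_gt_1: "1 < CARD('a :: {field, finite})"
proof -
  have "card {0, 1 :: 'a} \<le> CARD('a)" by (intro card_mono) auto
  then show ?thesis by simp
qed

lemma bij_power:
  assumes "coprime s (CARD('a :: {field, finite}) - 1)" "0 < s"
  shows "bij (\<lambda>x :: 'a. x ^ s)"
proof -
  let ?n = "CARD('a) - 1"
  have n: "0 < ?n" using card_field_gt_1[where 'a = 'a] by simp
  obtain t where "[s * t = Suc 0] (mod ?n)"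
    using cong_solve_coprime_nat[OF assms(1)] by auto
  \<comment> \<open>The inverse \<open>t\<close> may be 0 when \<open>?n = 1\<close>; adding
    \<open>?n\<close> makes the exponent positive, so that the power law also covers
    \<open>x = 0\<close>.\<close>
  then have t: "[(t + ?n) * s = 1] (mod ?n)"
    unfolding cong_def add_mult_distrib mult.commute[of ?n] mult.commute[of t] mod_mult_self1 by simp
  have "x ^ ((t + ?n) * s) = x" for x :: 'a
    using power_cong_card_minus_one[OF t, of x] n assms(2) by simp
  then have "surj (\<lambda>x :: 'a. x ^ s)"
    by (metis power_mult surjI)
  then show ?thesis
    by (simp add: bij_def finite_UNIV_surj_inj)
qed

context
  fixes p m :: nat
  assumes p: "prime p" and m: "m \<ge> 1"
    and card_field: "CARD('a :: {field, finite}) = p ^ m"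
begin

section \<open>The prime subfield\<close>

lemma CHAR_eq_p: "CHAR('a) = p"
proof -
  have "prime CHAR('a)"
    by (intro prime_CHAR_semidom finite_imp_CHAR_pos) simp
  moreover have "CHAR('a) dvd p ^ m"
    using CHAR_dvd_CARD[where 'a = 'a] card_field by simp
  ultimately show ?thesis
    using p prime_dvd_power primes_dvd_imp_eq by blast
qed

text \<open>The natural number \<open>p - 1\<close> represents \<open>- 1\<close>, which turns
  subtraction into addition and multiplication of naturals.\<close>

lemma prime_subfield_diff:
  assumes "a \<in> range of_nat" "b \<in> range of_nat"
  shows "a - b \<in> (range of_nat :: 'a set)"
proof -
  from assms obtain k l where kl: "a = of_nat k" "b = of_nat l" by auto
  have "of_nat p = (0 :: 'a)" using CHAR_eq_p of_nat_CHAR by metis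
  then have "of_nat (p - 1) = (- 1 :: 'a)"
    using prime_ge_1_nat[OF p] by (simp add: of_nat_diff del: One_nat_def)
  then have "a - b = of_nat (k + (p - 1) * l)" using kl by simp
  then show ?thesis by blast
qed

text \<open>The inverse of a nonzero \<open>b\<close> is its power with exponent
  \<open>q - 2\<close>, again the image of a natural number; for \<open>b = 0\<close> the quotient
  is 0.\<close>

lemma prime_subfield_divide:
  assumes "a \<in> range of_nat" "b \<in> range of_nat"
  shows "a / b \<in> (range of_nat :: 'a set)"
proof -
  from assms obtain k l where kl: "a = of_nat k" "b = of_nat l" by auto
  show ?thesis
  proof (cases "b = 0")
    case True
    then show ?thesis by (auto intro: image_eqI[of _ _ 0])
  next
    case False
    have "Suc (CARD('a) - 1 - 1) = CARD('a) - 1"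
      using card_field_gt_1[where 'a = 'a] by simp
    then have "b ^ Suc (CARD('a) - 1 - 1) = 1"
      using power_card_minus_one[OF False] by metis
    then have "a / b = a * b ^ (CARD('a) - 1 - 1)"
      using False by (simp add: field_simps del: One_nat_def)
    also have "\<dots> = of_nat (k * l ^ (CARD('a) - 1 - 1))" using kl by simp
    finally show ?thesis by blast
  qed
qed

lemma card_prime_subfield: "card (range of_nat :: 'a set) = p"
proof -
  have "range of_nat = (of_nat ` {..<p} :: 'a set)"
  proof
    show "range of_nat \<subseteq> (of_nat ` {..<p} :: 'a set)"
    proof safe
      fix k
      have "(of_nat k :: 'a) = of_nat (k mod p)"
        by (simp add: of_nat_eq_iff_cong_CHAR CHAR_eq_p cong_def)
      then show "(of_nat k :: 'a) \<in> of_nat ` {..<p}"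
        using p prime_gt_0_nat by auto
    qed
  qed auto
  moreover have "inj_on (of_nat :: nat \<Rightarrow> 'a) {..<p}"
    by (auto simp: inj_on_def of_nat_eq_iff_cong_CHAR CHAR_eq_p cong_def)
  ultimately show ?thesis by (simp add: card_image)
qed

section \<open>Counting independent tuples\<close>

lemma card_prime_coords: "card (prime_coords k :: (nat \<Rightarrow> 'a) set) = p ^ k"
  by (simp add: prime_coords_def card_PiE card_prime_subfield)

text \<open>A tuple stays independent exactly when the new vector avoids the span of the old ones.
  This is the step of the count of ordered bases.\<close>

lemma indep_tuple_Suc:
  fixes w :: "nat \<Rightarrow> 'a"
  shows "indep_tuple (Suc k) w \<longleftrightarrow>
    indep_tuple k w \<and> w k \<notin> (\<lambda>a. lincomb k a w) ` prime_coords k" (is "?L \<longleftrightarrow> ?R")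
proof
  have ext: "a(k := x) \<in> prime_coords (Suc k)" if "a \<in> prime_coords k" "x \<in> range of_nat"
    for a and x :: 'a
    using that by (auto simp: prime_coords_def PiE_iff extensional_def less_Suc_eq)
  have 01: "0 \<in> (range of_nat :: 'a set)" "1 \<in> (range of_nat :: 'a set)"
    by (auto intro: image_eqI[of _ _ 0] image_eqI[of _ _ 1])
  assume L: ?L
  show ?R
  proof (intro conjI notI)
    show "indep_tuple k w"
      unfolding indep_tuple_def
    proof (rule inj_onI)
      fix a b assume ab: "a \<in> prime_coords k" "b \<in> prime_coords k" "lincomb k a w = lincomb k b w"
      have "a(k := 0) = b(k := 0)"
        using L[unfolded indep_tuple_def] _ ext[OF ab(1) 01(1)] ext[OF ab(2) 01(1)]
        by (rule inj_onD) (use ab(3) in \<open>simp add: lincomb_def\<close>)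
      \<comment> \<open>Both values are \<open>undefined\<close>, because \<open>k\<close> lies
        outside the common domain.\<close>
      moreover have "a k = b k"
        using ab by (simp add: prime_coords_def PiE_iff extensional_def)
      ultimately show "a = b" by (metis fun_upd_triv fun_upd_upd)
    qed
  next
    assume "w k \<in> (\<lambda>a. lincomb k a w) ` prime_coords k"
    then obtain a where a: "a \<in> prime_coords k" "w k = lincomb k a w" by auto
    define z where "z = restrict (\<lambda>_. 0 :: 'a) {..<k}"
    have z: "z \<in> prime_coords k"
      by (auto simp: z_def prime_coords_def intro: image_eqI[of _ _ 0])
    have "lincomb k z w = 0" by (simp add: lincomb_def z_def)
    \<comment> \<open>If \<open>w k\<close> lies in the span, it has two coordinate vectors: that of
      the combination, and the unit vector at \<open>k\<close>.\<close>
    then have "lincomb (Suc k) (a(k := 0)) w = lincomb (Suc k) (z(k := 1)) w"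
      using a(2) by (simp add: lincomb_def)
    then have "a(k := 0) = z(k := 1)"
      using L[unfolded indep_tuple_def] ext[OF a(1) 01(1)] ext[OF z 01(2)]
      by (blast dest: inj_onD)
    then show False by (metis fun_upd_same zero_neq_one)
  qed
next
  assume R: ?R
  have res: "restrict (\<lambda>i. f i) {..<k} \<in> prime_coords k" if "\<And>i. i < k \<Longrightarrow> f i \<in> range of_nat"
    for f :: "nat \<Rightarrow> 'a"
    using that by (auto simp: prime_coords_def)
  show ?L
    unfolding indep_tuple_def
  proof (rule inj_onI)
    fix a b :: "nat \<Rightarrow> 'a"
    assume ab: "a \<in> prime_coords (Suc k)" "b \<in> prime_coords (Suc k)"
      and eq: "lincomb (Suc k) a w = lincomb (Suc k) b w"
    have mem: "a i \<in> range of_nat" "b i \<in> range of_nat" if "i \<le> k" for i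
      using ab that by (auto simp: prime_coords_def PiE_iff)
    have ak: "a k = b k"
    proof (rule ccontr)
      assume ne: "a k \<noteq> b k"
      \<comment> \<open>The equality of the two combinations is solved for \<open>w k\<close>; the
        quotients stay in the prime field, putting \<open>w k\<close> in the span.\<close>
      define f where "f = restrict (\<lambda>i. (a i - b i) / (b k - a k)) {..<k}"
      have "(b k - a k) * w k = lincomb k a w - lincomb k b w"
        using eq by (simp add: lincomb_def algebra_simps)
      also have "\<dots> = (b k - a k) * lincomb k f w"
        using ne by (simp add: lincomb_def f_def sum_distrib_left flip: sum_subtractf left_diff_distrib)
      finally have "w k = lincomb k f w" using ne by simp
      moreover have "f \<in> prime_coords k"
        unfolding f_def by (intro res prime_subfield_divide prime_subfield_diff mem) auto
      ultimately show False using R by blast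
    qed
    have "restrict a {..<k} = restrict b {..<k}"
    proof (rule inj_onD)
      show "inj_on (\<lambda>a. lincomb k a w) (prime_coords k)" using R by (simp add: indep_tuple_def)
      show "lincomb k (restrict a {..<k}) w = lincomb k (restrict b {..<k}) w"
        using eq ak by (simp add: lincomb_def)
      show "restrict a {..<k} \<in> prime_coords k" "restrict b {..<k} \<in> prime_coords k"
        using mem by (auto intro!: res)
    qed
    then have "a i = b i" if "i < k" for i using that by (metis lessThan_iff restrict_apply')
    then show "a = b"
      using ab ak by (intro PiE_ext[of a "{..<Suc k}" "\<lambda>_. range of_nat" b])
        (auto simp: prime_coords_def less_Suc_eq)
  qed
qed

text \<open>Vectors are chosen one at a time, each outside the \<open>p ^ i\<close> elements spanned
  by the \<open>i\<close> earlier ones. For \<open>k > m\<close> both sides vanish, as the factor at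
  \<open>i = m\<close> is 0.\<close>

lemma card_indep_tuples:
  "card {w :: nat \<Rightarrow> 'a. w \<in> {..<k} \<rightarrow>\<^sub>E UNIV \<and> indep_tuple k w} = (\<Prod>i<k. p ^ m - p ^ i)"
proof (induction k)
  case 0
  have "{w :: nat \<Rightarrow> 'a. w \<in> {..<0} \<rightarrow>\<^sub>E UNIV \<and> indep_tuple 0 w} = {\<lambda>_. undefined}"
    by (auto simp: indep_tuple_def prime_coords_def)
  then show ?case by simp
next
  case (Suc k)
  let ?W = "\<lambda>k. {w :: nat \<Rightarrow> 'a. w \<in> {..<k} \<rightarrow>\<^sub>E UNIV \<and> indep_tuple k w}"
  let ?S = "\<lambda>w. (\<lambda>a. lincomb k a w) ` prime_coords k"
  have fin: "finite (?W k)" by (rule finite_subset[of _ "{..<k} \<rightarrow>\<^sub>E UNIV"]) (auto intro: finite_PiE)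
  have "bij_betw (\<lambda>(w, v). w(k := v)) (SIGMA w : ?W k. UNIV - ?S w) (?W (Suc k))"
  \<comment> \<open>The inverse splits off the last vector; resetting position \<open>k\<close> to
    \<open>undefined\<close> restores extensionality on \<open>{..<k}\<close>.\<close>
  proof (rule bij_betwI[where g = "\<lambda>w. (w(k := undefined), w k)"])
    show "(\<lambda>(w, v). w(k := v)) \<in> (SIGMA w : ?W k. UNIV - ?S w) \<rightarrow> ?W (Suc k)"
      by (auto simp: indep_tuple_Suc lincomb_upd indep_tuple_upd PiE_iff extensional_def)
    show "(\<lambda>w. (w(k := undefined), w k)) \<in> ?W (Suc k) \<rightarrow> (SIGMA w : ?W k. UNIV - ?S w)"
      by (auto simp: indep_tuple_Suc lincomb_upd indep_tuple_upd PiE_iff extensional_def)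
  qed (auto simp: fun_eq_iff PiE_iff extensional_def)
  then have "card (?W (Suc k)) = card (SIGMA w : ?W k. UNIV - ?S w)"
    by (simp add: bij_betw_same_card)
  also have "\<dots> = (\<Sum>w\<in>?W k. card (UNIV - ?S w))"
    using fin by (intro card_SigmaI) auto
  also have "\<dots> = (\<Sum>w\<in>?W k. p ^ m - p ^ k)"
  proof (rule sum.cong)
    fix w assume "w \<in> ?W k"
    then have "card (?S w) = p ^ k"
      by (simp add: indep_tuple_def card_image card_prime_coords)
    then show "card (UNIV - ?S w) = p ^ m - p ^ k"
      by (simp add: card_Diff_subset card_field)
  qed simp
  finally show ?case using Suc.IH by simp
qed

section \<open>Linearized maps as linear maps over the prime field, and the number of bijective
  ones\<close>

lemma linearized_map_add: "linearized_map p m c (x + y) = linearized_map p m c x + linearized_map p m c (y :: 'a)"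
  by (simp add: linearized_map_def freshmans_dream'[of "p ^ _"] CHAR_eq_p p distrib_left sum.distrib)

lemma linearized_map_zero: "linearized_map p m c (0 :: 'a) = 0"
  using prime_gt_0_nat[OF p] by (simp add: linearized_map_def power_0_left)

text \<open>A scalar of the prime field is a repeated sum of 1, so additivity already gives
  linearity.\<close>

lemma linearized_map_of_nat_mult: "linearized_map p m c (of_nat k * x) = of_nat k * linearized_map p m c (x :: 'a)"
  by (induction k) (simp_all add: linearized_map_zero linearized_map_add algebra_simps)

lemma linearized_map_lincomb:
  assumes "a \<in> prime_coords k"
  shows "linearized_map p m c (lincomb k a w) = lincomb k a (\<lambda>i. linearized_map p m c (w i :: 'a))"
proof -
  \<comment> \<open>The induction runs over the number \<open>l\<close> of summands while
    \<open>a\<close> keeps its fixed length \<open>k\<close>.\<close>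
  have "linearized_map p m c (\<Sum>i<l. a i * w i) = (\<Sum>i<l. a i * linearized_map p m c (w i))" if "l \<le> k" for l
    using that
  proof (induction l)
    case (Suc l)
    then have "a l \<in> range of_nat"
      using assms by (auto simp: prime_coords_def PiE_iff)
    then obtain t where "a l = of_nat t" by blast
    then show ?case using Suc by (simp add: linearized_map_add linearized_map_of_nat_mult)
  qed (simp add: linearized_map_zero)
  then show ?thesis by (simp add: lincomb_def)
qed

lemma inj_on_power_prime: "inj_on (\<lambda>j. p ^ j) A"
  using p prime_gt_1_nat by (auto simp: inj_on_def)

text \<open>The exponents \<open>p ^ j\<close> with \<open>j < m\<close> are distinct and below
  \<open>q\<close>, so the function determines the polynomial and hence its coefficients.\<close>

lemma linearized_map_inject:
  assumes "linearized_map p m c = linearized_map p m (d :: nat \<Rightarrow> 'a)" "j < m"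
  shows "c j = d j"
proof -
  have less: "p ^ i < CARD('a)" if "i < m" for i
    using that p prime_gt_1_nat by (simp add: card_field)
  have "(\<Sum>j<m. Polynomial.monom (c j) (p ^ j)) = (\<Sum>j<m. Polynomial.monom (d j) (p ^ j))"
    using assms(1) by (intro poly_inject_card degree_sum_monom_less less)
      (auto simp: fun_eq_iff poly_sum_monom linearized_map_def)
  then show ?thesis
    using coeff_sum_monom[OF inj_on_power_prime assms(2)] by metis
qed

text \<open>For a basis \<open>b\<close> over the prime field, the map sending \<open>c\<close> to the values of \<open>L\<^sub>c\<close> on \<open>b\<close> is
  injective from \<open>q ^ m\<close> coefficient vectors into \<open>q ^ m\<close> tuples, hence bijective, and \<open>L\<^sub>c\<close> is a
  permutation exactly when the image of \<open>b\<close> is independent.\<close>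

lemma card_bij_linearized_map:
  "card {c :: nat \<Rightarrow> 'a. c \<in> {..<m} \<rightarrow>\<^sub>E UNIV \<and> bij (linearized_map p m c)} = (\<Prod>k<m. p ^ m - p ^ k)"
proof -
  let ?A = "{..<m} \<rightarrow>\<^sub>E (UNIV :: 'a set)"
  \<comment> \<open>A basis is obtained from the count: every factor \<open>p ^ m - p ^ i\<close>
    with \<open>i < m\<close> is positive.\<close>
  have "{w :: nat \<Rightarrow> 'a. w \<in> ?A \<and> indep_tuple m w} \<noteq> {}"
  proof
    assume "{w :: nat \<Rightarrow> 'a. w \<in> ?A \<and> indep_tuple m w} = {}"
    then have "(\<Prod>i<m. p ^ m - p ^ i) = 0" using card_indep_tuples[of m] by (metis card.empty)
    then show False using prime_gt_1_nat[OF p] by (auto simp: not_le)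
  qed
  then obtain b :: "nat \<Rightarrow> 'a" where b: "indep_tuple m b" by auto
  then have "card ((\<lambda>a. lincomb m a b) ` prime_coords m) = CARD('a)"
    by (simp add: indep_tuple_def card_image card_prime_coords card_field)
  then have span: "(\<lambda>a. lincomb m a b) ` prime_coords m = UNIV"
    by (simp add: card_eq_UNIV_imp_eq_UNIV)
  define V where "V c = restrict (\<lambda>i. linearized_map p m c (b i)) {..<m}" for c
  have linearized_map_V: "linearized_map p m c (lincomb m a b) = lincomb m a (V c)" if "a \<in> prime_coords m" for a c
    using linearized_map_lincomb[OF that] by (simp add: lincomb_def V_def)
  have V_inj: "inj_on V ?A"
  proof (rule inj_onI)
    fix c d assume cd: "c \<in> ?A" "d \<in> ?A" "V c = V d"
    have "linearized_map p m c = linearized_map p m d"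
    proof
      fix x
      obtain a where "a \<in> prime_coords m" "x = lincomb m a b" using span by blast
      then show "linearized_map p m c x = linearized_map p m d x" using cd(3) linearized_map_V by metis
    qed
    then show "c = d"
      by (intro PiE_ext[OF cd(1,2)]) (rule linearized_map_inject, simp_all)
  qed
  have V_surj: "V ` ?A = ?A"
  proof (rule endo_inj_surj[OF _ _ V_inj])
    show "finite ?A" by (simp add: finite_PiE)
    show "V ` ?A \<subseteq> ?A" unfolding V_def by (rule image_subsetI) simp
  qed
  have bij_iff: "bij (linearized_map p m c) \<longleftrightarrow> indep_tuple m (V c)" for c
  proof -
    have "bij (linearized_map p m c) \<longleftrightarrow> inj_on (linearized_map p m c) ((\<lambda>a. lincomb m a b) ` prime_coords m)"
      unfolding span bij_def using finite_UNIV_inj_surj[of "linearized_map p m c"] by auto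
    also have "\<dots> \<longleftrightarrow> inj_on (linearized_map p m c \<circ> (\<lambda>a. lincomb m a b)) (prime_coords m)"
      using b unfolding indep_tuple_def by (rule comp_inj_on_iff)
    also have "\<dots> \<longleftrightarrow> indep_tuple m (V c)"
      unfolding indep_tuple_def by (rule inj_on_cong) (simp add: linearized_map_V)
    finally show ?thesis .
  qed
  have "V ` {c. c \<in> ?A \<and> bij (linearized_map p m c)} = {w. w \<in> V ` ?A \<and> indep_tuple m w}"
    unfolding bij_iff by blast
  moreover have "inj_on V {c. c \<in> ?A \<and> bij (linearized_map p m c)}"
    by (rule inj_on_subset[OF V_inj]) blast
  ultimately show ?thesis
    using card_indep_tuples[of m] unfolding V_surj by (metis (no_types, lifting) card_image)
qed

lemma linearized_permutations_iff:
  "g \<in> poly ` {L :: 'a poly. linearized_permutation_poly p m L} \<longleftrightarrow> (\<exists>c. g = linearized_map p m c) \<and> bij g"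
proof -
  have "poly (\<Sum>j<m. Polynomial.monom (c j) (p ^ j)) = linearized_map p m c" for c :: "nat \<Rightarrow> 'a"
    by (simp add: fun_eq_iff poly_sum_monom linearized_map_def)
  then show ?thesis unfolding linearized_permutation_poly_def image_iff by (auto; metis)
qed

lemma linearized_permutations_eq:
  "poly ` {L :: 'a poly. linearized_permutation_poly p m L} =
     linearized_map p m ` {c. c \<in> {..<m} \<rightarrow>\<^sub>E UNIV \<and> bij (linearized_map p m c)}"
proof (intro equalityI subsetI)
  fix g :: "'a \<Rightarrow> 'a"
  assume "g \<in> poly ` {L :: 'a poly. linearized_permutation_poly p m L}"
  then obtain c where "g = linearized_map p m c" "bij (linearized_map p m c)"
    unfolding linearized_permutations_iff by auto
  moreover have "linearized_map p m c = linearized_map p m (restrict c {..<m})"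
    by (simp add: fun_eq_iff linearized_map_def)
  ultimately show "g \<in> linearized_map p m ` {c. c \<in> {..<m} \<rightarrow>\<^sub>E UNIV \<and> bij (linearized_map p m c)}"
    by (intro image_eqI[of _ _ "restrict c {..<m}"]) auto
qed (use linearized_permutations_iff in blast)

lemma card_linearized_permutations:
  "card (poly ` {L :: 'a poly. linearized_permutation_poly p m L}) = (\<Prod>k<m. p ^ m - p ^ k)"
  unfolding linearized_permutations_eq
proof (subst card_image)
  show "inj_on (linearized_map p m) {c :: nat \<Rightarrow> 'a. c \<in> {..<m} \<rightarrow>\<^sub>E UNIV \<and> bij (linearized_map p m c)}"
  proof (rule inj_onI)
    fix c d :: "nat \<Rightarrow> 'a"
    assume cd: "c \<in> {c. c \<in> {..<m} \<rightarrow>\<^sub>E UNIV \<and> bij (linearized_map p m c)}"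
      "d \<in> {c. c \<in> {..<m} \<rightarrow>\<^sub>E UNIV \<and> bij (linearized_map p m c)}" "linearized_map p m c = linearized_map p m d"
    then show "c = d"
      by (intro PiE_ext[of c "{..<m}" "\<lambda>_. UNIV" d]) (auto intro: linearized_map_inject[OF cd(3)])
  qed
qed (rule card_bij_linearized_map)

section \<open>Frobenius and the cosets of exponents\<close>

lemma power_field_card: "x ^ (p ^ m) = (x :: 'a)"
proof -
  have "1 < p ^ m" using card_field_gt_1[where 'a = 'a] card_field by simp
  then have "[p ^ m = 1] (mod (CARD('a) - 1))"
    by (simp add: card_field cong_altdef_nat)
  then show ?thesis
    using power_cong_card_minus_one[of "p ^ m" 1 x] p prime_gt_0_nat by simp
qed

text \<open>Substituting \<open>x ^ p\<close> shifts the coefficients cyclically, because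
  \<open>x ^ p ^ m = x\<close>.\<close>

lemma linearized_map_frobenius: "\<exists>d. (\<lambda>x :: 'a. linearized_map p m c (x ^ p ^ k)) = linearized_map p m d"
proof (induction k)
  case (Suc k)
  then obtain d where d: "(\<lambda>x :: 'a. linearized_map p m c (x ^ p ^ k)) = linearized_map p m d" by blast
  obtain l where l: "m = Suc l" using m by (cases m) auto
  \<comment> \<open>The top coefficient \<open>d l\<close> wraps around to index 0 and every other
    one moves up by one.\<close>
  define e where "e = case_nat (d l) d"
  have "linearized_map p m d (x ^ p) = linearized_map p m e x" for x
  proof -
    have "linearized_map p m d (x ^ p) = (\<Sum>j<l. d j * x ^ p ^ Suc j) + d l * x ^ p ^ m"
      unfolding linearized_map_def l by (simp add: power_mult[symmetric])
    also have "\<dots> = linearized_map p m e x"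
      unfolding power_field_card unfolding linearized_map_def l sum.lessThan_Suc_shift
      by (simp add: e_def)
    finally show ?thesis .
  qed
  moreover have "linearized_map p m c (x ^ p ^ Suc k) = linearized_map p m d (x ^ p)" for x
    using fun_cong[OF d, of "x ^ p"] by (simp add: power_mult[symmetric])
  ultimately show ?case by auto
qed auto

text \<open>These powers of \<open>p\<close> all lie between 1 and \<open>p ^ m - 1\<close>, where
  congruent numbers are equal.\<close>

lemma cong_prime_powers:
  assumes "[p ^ i = p ^ j] (mod (p ^ m - 1))" "i < m" "j < m"
  shows "i = j"
proof -
  have "p ^ k \<le> p ^ m - 1" if "k < m" for k
    using power_strict_increasing[OF that prime_gt_1_nat[OF p]] by simp
  then have "p ^ i = p ^ j"
    using assms prime_gt_0_nat[OF p] by (intro cong_imp_eq_positive[OF assms(1)]) auto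
  then show ?thesis using inj_on_power_prime[of UNIV] by (auto simp: inj_on_def)
qed

lemma pos_order: "0 < p ^ m - 1"
  using card_field_gt_1[where 'a = 'a] card_field by simp

text \<open>Cancelling the unit \<open>s\<close> leaves powers of \<open>p\<close>; thus the coset
  of \<open>s\<close> has exactly \<open>m\<close> elements.\<close>

lemma inj_on_reduce_exp_powers:
  assumes "coprime s (p ^ m - 1)" "0 < s"
  shows "inj_on (\<lambda>j. reduce_exp (p ^ m - 1) (s * p ^ j)) {..<m}"
proof (rule inj_onI)
  fix i j assume ij: "i \<in> {..<m}" "j \<in> {..<m}"
    "reduce_exp (p ^ m - 1) (s * p ^ i) = reduce_exp (p ^ m - 1) (s * p ^ j)"
  then have "[s * p ^ i = s * p ^ j] (mod (p ^ m - 1))"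
    using reduce_exp_eq_iff[OF pos_order] assms(2) prime_gt_0_nat[OF p] by simp
  then show "i = j"
    using ij assms(1) cong_prime_powers by (simp add: cong_mult_lcancel_nat)
qed

lemma cong_power_mod: "[p ^ k = p ^ (k mod m)] (mod (p ^ m - 1))"
proof -
  have "[p ^ m = 1] (mod (p ^ m - 1))"
    using pos_order by (simp add: cong_altdef_nat)
  then have "[(p ^ m) ^ (k div m) * p ^ (k mod m) = 1 ^ (k div m) * p ^ (k mod m)] (mod (p ^ m - 1))"
    by (intro cong_mult cong_pow) auto
  then show ?thesis by (simp add: power_mult[symmetric] power_add[symmetric])
qed

text \<open>Both sides, after reducing exponents, are polynomials of degree less than \<open>q\<close>, hence equal, so a
  monomial occurring on the left occurs on the right.\<close>

lemma linearized_map_power_eq_exponents: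
  assumes eq: "\<And>x :: 'a. linearized_map p m c (x ^ s) = linearized_map p m d (x ^ t)" and "bij (linearized_map p m c)"
    and s: "coprime s (p ^ m - 1)" "0 < s" and t: "0 < t"
  shows "\<exists>k<m. reduce_exp (p ^ m - 1) t = reduce_exp (p ^ m - 1) (s * p ^ k)"
proof -
  let ?n = "p ^ m - 1"
  let ?poly = "\<lambda>c s. \<Sum>j<m. Polynomial.monom (c j :: 'a) (reduce_exp ?n (s * p ^ j))"
  have p0: "0 < p ^ j" for j using prime_gt_0_nat[OF p] by simp
  have val: "poly (?poly c s) x = linearized_map p m c (x ^ s)" if "0 < s" for c s x
  proof -
    have "x ^ reduce_exp ?n (s * p ^ j) = (x ^ s) ^ p ^ j" for j
      unfolding power_mult[symmetric] using that p0 reduce_exp_bounds(1)[OF pos_order] card_field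
      by (intro power_cong_card_minus_one) (simp_all add: reduce_exp_cong)
    then show ?thesis by (simp add: poly_sum_monom linearized_map_def)
  qed
  have deg: "degree (?poly c s) < CARD('a)" for c s
  proof (rule degree_sum_monom_less)
    show "reduce_exp ?n (s * p ^ j) < CARD('a)" for j
      using reduce_exp_bounds(2)[OF pos_order, of "s * p ^ j"] pos_order card_field by linarith
  qed simp
  have "?poly c s = ?poly d t"
    using s(2) t by (intro poly_inject_card deg) (rule ext, simp only: val eq)
  \<comment> \<open>A bijection is not identically zero, so some coefficient of \<open>c\<close>
    survives.\<close>
  obtain j where j: "j < m" "c j \<noteq> 0"
  proof (rule ccontr)
    assume "\<not> thesis"
    then have "c j = 0" if "j < m" for j using \<open>\<And>j. j < m \<Longrightarrow> c j \<noteq> 0 \<Longrightarrow> thesis\<close> that by blast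
    then have "linearized_map p m c x = 0" for x by (simp add: linearized_map_def)
    then show False using \<open>bij (linearized_map p m c)\<close> zero_neq_one by (metis bij_pointE)
  qed
  \<comment> \<open>Exponents on the left are pairwise distinct, so this coefficient is
    \<open>c j\<close>. On the right they might collide, but a nonzero coefficient still needs a
    term with this exponent.\<close>
  have "poly.coeff (?poly d t) (reduce_exp ?n (s * p ^ j)) \<noteq> 0"
    using coeff_sum_monom[OF inj_on_reduce_exp_powers[OF s] j(1), of c] j(2) \<open>?poly c s = ?poly d t\<close> by simp
  then obtain i where "i \<in> {..<m}"
      "(if reduce_exp ?n (t * p ^ i) = reduce_exp ?n (s * p ^ j) then d i else 0) \<noteq> 0"
    unfolding coeff_sum Polynomial.coeff_monom by (rule sum.not_neutral_contains_not_neutral)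
  then have i: "i < m" "reduce_exp ?n (t * p ^ i) = reduce_exp ?n (s * p ^ j)"
    by (auto split: if_splits)
  then have "[t * p ^ i = s * p ^ j] (mod ?n)"
    using reduce_exp_eq_iff[OF pos_order] s(2) t p0 by simp
  \<comment> \<open>The factor \<open>p ^ (m - i)\<close> inverts \<open>p ^ i\<close>, since
    \<open>p ^ m\<close> is 1 modulo \<open>?n\<close>.\<close>
  then have "[t * p ^ i * p ^ (m - i) = s * p ^ j * p ^ (m - i)] (mod ?n)"
    by (rule cong_scalar_right)
  then have "[t * p ^ m = s * p ^ (j + (m - i))] (mod ?n)"
    using i(1) by (simp add: mult.assoc power_add[symmetric])
  moreover have "[t * p ^ m = t * p ^ 0] (mod ?n)"
    using cong_power_mod[of m] by (intro cong_mult) simp_all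
  moreover have "[s * p ^ (j + (m - i)) = s * p ^ ((j + (m - i)) mod m)] (mod ?n)"
    by (intro cong_mult cong_power_mod) simp
  ultimately have "[t = s * p ^ ((j + (m - i)) mod m)] (mod ?n)"
    by (metis cong_sym cong_trans mult_1_right power_0)
  then have "reduce_exp ?n t = reduce_exp ?n (s * p ^ ((j + (m - i)) mod m))"
    using reduce_exp_eq_iff[OF pos_order] s(2) t p0 by simp
  then show ?thesis using m by (intro exI[of _ "(j + (m - i)) mod m"]) auto
qed

section \<open>Fibres of the map from pairs to functions\<close>

lemma reduce_exp_totative:
  assumes "coprime s (p ^ m - 1)" "0 < s"
  shows "reduce_exp (p ^ m - 1) s \<in> totatives (p ^ m - 1)"
proof -
  have "coprime (reduce_exp (p ^ m - 1) s) (p ^ m - 1)"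
    using cong_imp_coprime[OF cong_sym[OF reduce_exp_cong[OF assms(2)]] assms(1)] .
  then show ?thesis
    using reduce_exp_bounds[OF pos_order] by (simp add: in_totatives_iff)
qed

text \<open>The fibre projects injectively to the exponent \<open>t\<close>, because the power map
  is onto and so \<open>t\<close> determines \<open>h\<close>. The exponents that occur form the
  coset of \<open>s\<close>.\<close>

lemma card_fibre:
  fixes g :: "'a \<Rightarrow> 'a"
  defines "G \<equiv> poly ` {L :: 'a poly. linearized_permutation_poly p m L}"
  assumes g: "g \<in> G" and s: "s \<in> totatives (p ^ m - 1)"
  shows "card {(h, t) \<in> G \<times> totatives (p ^ m - 1). (\<lambda>x. h (x ^ t)) = (\<lambda>x. g (x ^ s))} = m"
    (is "card ?F = m")
proof -
  let ?n = "p ^ m - 1"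
  have s': "0 < s" "s \<le> ?n" "coprime s ?n" using s by (auto simp: in_totatives_iff)
  have p0: "0 < p ^ j" for j using prime_gt_0_nat[OF p] by simp
  have "inj_on snd ?F"
  proof (rule inj_onI)
    fix y z assume yz: "y \<in> ?F" "z \<in> ?F" "snd y = snd z"
    then obtain h h' t where eq: "y = (h, t)" "z = (h', t)" by (cases y; cases z) auto
    have t: "coprime t ?n" "0 < t" using yz eq by (auto simp: in_totatives_iff)
    have "h x = h' x" for x
    proof -
      obtain u where "x = u ^ t"
        using bij_power[of t, where 'a = 'a] t card_field by (metis bij_pointE)
      moreover have "(\<lambda>x. h (x ^ t)) = (\<lambda>x. h' (x ^ t))" using yz(1,2) unfolding eq by simp
      then have "h (u ^ t) = h' (u ^ t)" by (rule fun_cong)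
      ultimately show ?thesis by simp
    qed
    then show "y = z" using eq by auto
  qed
  moreover have "snd ` ?F = (\<lambda>j. reduce_exp ?n (s * p ^ j)) ` {..<m}"
  proof (intro equalityI subsetI)
    fix t assume "t \<in> snd ` ?F"
    then obtain h where h: "h \<in> G" "t \<in> totatives ?n" "(\<lambda>x. h (x ^ t)) = (\<lambda>x. g (x ^ s))" by auto
    obtain c d where "g = linearized_map p m c" "bij g" "h = linearized_map p m d"
      using g h(1) unfolding G_def linearized_permutations_iff by auto
    then have "\<exists>k<m. reduce_exp ?n t = reduce_exp ?n (s * p ^ k)"
      using h(2) s' fun_cong[OF h(3)] by (intro linearized_map_power_eq_exponents[of c s d t])
        (simp_all add: in_totatives_iff)
    moreover have "reduce_exp ?n t = t" using h(2) by (simp add: reduce_exp_idem in_totatives_iff)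
    ultimately show "t \<in> (\<lambda>j. reduce_exp ?n (s * p ^ j)) ` {..<m}" by auto
  next
    fix t assume "t \<in> (\<lambda>j. reduce_exp ?n (s * p ^ j)) ` {..<m}"
    then obtain k where k: "k < m" "t = reduce_exp ?n (s * p ^ k)" by auto
    obtain c where c: "g = linearized_map p m c" "bij g"
      using g unfolding G_def linearized_permutations_iff by auto
    \<comment> \<open>Frobenius to the power \<open>m - k\<close> compensates the factor
      \<open>p ^ k\<close> in \<open>t\<close>: together they give \<open>p ^ m\<close>, which acts
      as the identity.\<close>
    obtain d where d: "(\<lambda>x :: 'a. linearized_map p m c (x ^ p ^ (m - k))) = linearized_map p m d"
      using linearized_map_frobenius by blast
    have cp: "coprime (p ^ j) ?n" for j
    proof -
      have "coprime (p ^ m) ?n" using p0 coprime_diff_one_right_nat by blast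
      then show ?thesis using m by (simp add: coprime_power_left_iff)
    qed
    have "linearized_map p m d = linearized_map p m c \<circ> (\<lambda>x. x ^ p ^ (m - k))"
      using d by (simp add: o_def)
    then have "bij (linearized_map p m d)"
      using c cp p0 bij_power[of "p ^ (m - k)", where 'a = 'a] card_field by (auto intro: bij_comp)
    then have "linearized_map p m d \<in> G" unfolding G_def linearized_permutations_iff by auto
    moreover have "t \<in> totatives ?n"
      unfolding k(2) using s'(1,3) p0[of k] cp[of k]
      by (intro reduce_exp_totative) (simp_all only: coprime_mult_left_iff nat_0_less_mult_iff simp_thms)
    moreover have "linearized_map p m d (x ^ t) = g (x ^ s)" for x
    proof -
      have "x ^ t = x ^ (s * p ^ k)"
        unfolding k(2) using s'(1) p0[of k] reduce_exp_bounds(1)[OF pos_order] card_field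
        by (intro power_cong_card_minus_one) (simp_all add: reduce_exp_cong)
      then have "(x ^ t) ^ p ^ (m - k) = (x ^ s) ^ p ^ m"
        using k(1) by (simp add: power_mult[symmetric] mult.assoc power_add[symmetric])
      then show ?thesis
        using fun_cong[OF d, of "x ^ t"] c by (simp add: power_field_card)
    qed
    ultimately have "(linearized_map p m d, t) \<in> ?F" by auto
    then show "t \<in> snd ` ?F" by force
  qed
  moreover have "card ((\<lambda>j. reduce_exp ?n (s * p ^ j)) ` {..<m}) = m"
    using card_image[OF inj_on_reduce_exp_powers[OF s'(3,1)]] by simp
  ultimately show ?thesis
    using card_image[of snd ?F] by argo
qed

text \<open>All fibres have \<open>m\<close> elements, so the number of pairs is \<open>m\<close>
  times the number of functions; the product form avoids division of naturals.\<close>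

lemma card_linearized_power_maps:
  defines "G \<equiv> poly ` {L :: 'a poly. linearized_permutation_poly p m L}"
  shows "card ((\<lambda>(g, s) x. g (x ^ s)) ` (G \<times> totatives (p ^ m - 1))) * m
    = totient (p ^ m - 1) * (\<Prod>k<m. p ^ m - p ^ k)"
proof -
  let ?D = "G \<times> totatives (p ^ m - 1)" and ?\<Phi> = "\<lambda>(g, s) x. g (x ^ s) :: 'a"
  have fin: "finite ?D" by simp
  have fibre: "card {z \<in> ?D. ?\<Phi> z = y} = m" if y: "y \<in> ?\<Phi> ` ?D" for y
  proof -
    obtain g s where gs: "g \<in> G" "s \<in> totatives (p ^ m - 1)" "y = (\<lambda>x. g (x ^ s))"
      using y by auto
    have "{z \<in> ?D. ?\<Phi> z = y} =
        {(h, t) \<in> G \<times> totatives (p ^ m - 1). (\<lambda>x. h (x ^ t)) = (\<lambda>x. g (x ^ s))}"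
      using gs(3) by auto
    then show ?thesis using card_fibre gs(1,2) unfolding G_def by simp
  qed
  have "card ?D = (\<Sum>y\<in>?\<Phi> ` ?D. card {z \<in> ?D. ?\<Phi> z = y})"
    unfolding card_eq_sum by (rule sum.image_gen[OF fin])
  also have "\<dots> = card (?\<Phi> ` ?D) * m" using fibre by simp
  finally show ?thesis
    using card_linearized_permutations
    by (simp add: card_cartesian_product totient_def G_def mult.commute)
qed

section \<open>The Costas property and reduction of polynomials\<close>

lemma costas_linearized_power:
  assumes L: "linearized_permutation_poly p m (L :: 'a poly)"
    and s: "coprime s (p ^ m - 1)" "0 < s"
  shows "costas_poly (pcompose L (Polynomial.monom 1 s))"
  unfolding costas_poly_def
proof (intro conjI allI impI)
  obtain c where c: "poly L = linearized_map p m c" "bij (poly L)"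
    using L linearized_permutations_iff[of "poly L"] by auto
  have val: "poly (pcompose L (Polynomial.monom 1 s)) x = linearized_map p m c (x ^ s)" for x
    by (simp add: poly_pcompose Polynomial.poly_monom c)
  show "poly (pcompose L (Polynomial.monom 1 s)) 0 = 0"
    using s(2) by (simp add: val linearized_map_zero zero_power)
  have bij: "bij (\<lambda>x :: 'a. x ^ s)" using bij_power[of s, where 'a = 'a] s card_field by simp
  fix d :: 'a assume "d \<noteq> 1"
  then have "d ^ s \<noteq> 1" using bij_is_inj[OF bij, THEN injD, of d 1] by auto
  then have "bij (\<lambda>x. (d ^ s - 1) * x)"
    by (intro o_bij[where g = "\<lambda>x. x / (d ^ s - 1)"]) auto
  \<comment> \<open>The difference map is a composition of three bijections: the power map, a
    nonzero scaling and the linearized map.\<close>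
  then have "bij (linearized_map p m c \<circ> (\<lambda>x. (d ^ s - 1) * x) \<circ> (\<lambda>x. x ^ s))"
    using bij c by (intro bij_comp) auto
  moreover have "linearized_map p m c ((d * x) ^ s) - linearized_map p m c (x ^ s) = linearized_map p m c ((d ^ s - 1) * x ^ s)" for x
    using linearized_map_add[of c "(d ^ s - 1) * x ^ s" "x ^ s"]
    by (simp add: power_mult_distrib algebra_simps)
  ultimately show "bij (\<lambda>x. poly (pcompose L (Polynomial.monom 1 s)) (d * x)
      - poly (pcompose L (Polynomial.monom 1 s)) x)"
    by (simp add: val o_def)
qed

text \<open>\<open>h\<close> vanishes on the whole field, so remainders induce the same functions;
  their degree is below \<open>q\<close>, so distinct remainders induce distinct functions.\<close>

lemma card_image_mod:
  fixes A :: "'a poly set"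
  defines "h \<equiv> Polynomial.monom 1 (p ^ m) - Polynomial.monom 1 1"
  shows "card ((\<lambda>f. f mod h) ` A) = card (poly ` A)"
proof -
  have q: "1 < p ^ m" using card_field_gt_1[where 'a = 'a] card_field by simp
  have "poly h x = 0" for x
    by (simp add: h_def Polynomial.poly_monom power_field_card)
  then have "poly f x = poly (f mod h) x" for f x
    using arg_cong[OF div_mult_mod_eq[of f h], of "\<lambda>f. poly f x"]
    by (simp only: poly_add poly_mult mult_zero_right add_0_left)
  then have mod_val: "poly (f mod h) = poly f" for f by (rule ext[symmetric])
  have "degree h = p ^ m"
    unfolding h_def diff_conv_add_uminus using q
    by (subst degree_add_eq_left) (auto simp: Polynomial.degree_monom_eq)
  then have deg: "degree (f mod h) < CARD('a)" for f
    using degree_mod_less'[of h f] q card_field prime_gt_0_nat[OF p]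
    by (cases "f mod h = 0"; cases "h = 0") auto
  have "inj_on poly ((\<lambda>f. f mod h) ` A)"
    by (rule inj_onI) (auto intro: poly_inject_card deg)
  moreover have "poly ` (\<lambda>f. f mod h) ` A = poly ` A"
    by (simp add: image_image mod_val)
  ultimately show ?thesis by (metis card_image)
qed

text \<open>Reducing \<open>s\<close> to its representative among the totatives leaves the function
  unchanged, and the Costas condition holds automatically.\<close>

lemma costas_functions_eq:
  "poly ` {f :: 'a poly. costas_poly f \<and>
      (\<exists>L s. linearized_permutation_poly p m L \<and> s > 0 \<and> coprime s (p ^ m - 1) \<and>
        f = pcompose L (Polynomial.monom 1 s))}
   = (\<lambda>(g, s) x. g (x ^ s)) `
      (poly ` {L :: 'a poly. linearized_permutation_poly p m L} \<times> totatives (p ^ m - 1))"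
  (is "poly ` ?A = ?B")
proof (intro equalityI subsetI)
  fix h assume "h \<in> poly ` ?A"
  then obtain L s where Ls: "linearized_permutation_poly p m L" "0 < s" "coprime s (p ^ m - 1)"
      "h = poly (pcompose L (Polynomial.monom 1 s))"
    by auto
  have "x ^ reduce_exp (p ^ m - 1) s = x ^ s" for x :: 'a
    using Ls(2) reduce_exp_bounds(1)[OF pos_order] card_field
    by (intro power_cong_card_minus_one) (simp_all add: reduce_exp_cong)
  then have "h = (\<lambda>x. poly L (x ^ reduce_exp (p ^ m - 1) s))"
    by (simp add: fun_eq_iff Ls(4) poly_pcompose Polynomial.poly_monom)
  then show "h \<in> ?B"
    using Ls(1) reduce_exp_totative[OF Ls(3,2)]
    by (intro image_eqI[of _ _ "(poly L, reduce_exp (p ^ m - 1) s)"]) auto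
next
  fix h assume "h \<in> ?B"
  then obtain L s where Ls: "linearized_permutation_poly p m L" "s \<in> totatives (p ^ m - 1)"
      "h = (\<lambda>x. poly L (x ^ s))"
    by auto
  have "h = poly (pcompose L (Polynomial.monom 1 s))"
    by (simp add: fun_eq_iff Ls(3) poly_pcompose Polynomial.poly_monom)
  then show "h \<in> poly ` ?A"
    using Ls costas_linearized_power[OF Ls(1)] by (auto simp: in_totatives_iff)
qed

end

theorem theorem6p1:
  fixes p m :: nat
  assumes "prime p" and "m \<ge> 1" and "card (UNIV :: 'a :: {field, finite} set) = p ^ m"
  shows "real (card ((\<lambda>f. f mod (Polynomial.monom 1 (p ^ m) - Polynomial.monom 1 1)) `
           {f :: 'a poly. costas_poly f \<and>
              (\<exists>L s. linearized_permutation_poly p m L \<and> s > 0 \<and> coprime s (p ^ m - 1) \<and>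
                     f = pcompose L (Polynomial.monom 1 s))}))
         = real (totient (p ^ m - 1)) / real m * (\<Prod>k<m. real (p ^ m) - real (p ^ k))"
proof -
  let ?N = "card ((\<lambda>f. f mod (Polynomial.monom 1 (p ^ m) - Polynomial.monom 1 1)) `
           {f :: 'a poly. costas_poly f \<and>
              (\<exists>L s. linearized_permutation_poly p m L \<and> s > 0 \<and> coprime s (p ^ m - 1) \<and>
                     f = pcompose L (Polynomial.monom 1 s))})"
  have "?N * m = totient (p ^ m - 1) * (\<Prod>k<m. p ^ m - p ^ k)"
    unfolding card_image_mod[OF assms] costas_functions_eq[OF assms]
    by (rule card_linearized_power_maps[OF assms])
  then have "real ?N * real m = real (totient (p ^ m - 1)) * real (\<Prod>k<m. p ^ m - p ^ k)"
    unfolding of_nat_mult[symmetric] by (rule arg_cong)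
  \<comment> \<open>For \<open>k < m\<close> the natural subtraction is not truncated, so it agrees
    with the real one.\<close>
  also have "real (\<Prod>k<m. p ^ m - p ^ k) = (\<Prod>k<m. real (p ^ m) - real (p ^ k))"
    unfolding of_nat_prod
    by (intro prod.cong refl of_nat_diff power_increasing) (use prime_ge_1_nat[OF assms(1)] in auto)
  finally show ?thesis using assms(2) by (simp add: field_simps)
qed

end
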